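(* Let $d\ge 2$ be an integer and $1\le p,s,r\le\infty$. Let $\mathcal Q$ be a set of prime powers, and for each $q\in\mathcal Q$ let $j=j_q\in\mathbb F_q^*$ and let $\mathcal A=\mathcal A_q$ be a set of functions $\mathbb F_q^d\to\mathbb C$. Suppose that there is a constant $C>0$ independent of $q$ such that for all $q\in\mathcal Q$ and all $g\in\mathcal A_q$: (i) $\|\widehat{\mathcal Sg}\|_{L^r(H_j^d)}\le C\,\|\mathcal Sg\|_{\ell^s(\mathbb F_q^{d+1})}$, and (ii) $\|\mathcal Sg\|_{\ell^s(\mathbb F_q^{d+1})}\le C\,\|g\|_{\ell^p(\mathbb F_q^d)}$. Then there is a constant $C'>0$ independent of $q$ such that for all $q\in\mathcal Q$ and all $g\in\mathcal A_q$, $$\|\widehat g\|_{L^r(S_j^{d-1})}\le C'\,\|g\|_{\ell^p(\mathbb F_q^d)}$$ (in the paper's notation, $R^{\mathcal A}_{S_j^{d-1}}(p\to r)\lesssim 1$).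
   Context: For $x=(x_1,\dots,x_n)\in\mathbb F_q^n$ put $\|x\|:=\sum_{i=1}^n x_i^2$. $S_j^{d-1}:=\{x\in\mathbb F_q^d:\|x\|=j\}$ and $H_j^d:=\{(x,x_{d+1})\in\mathbb F_q^d\times\mathbb F_q:\|x\|=jx_{d+1}^2\}\subset\mathbb F_q^{d+1}$. $\chi$ is a fixed non-trivial additive character of $\mathbb F_q$; for $h:\mathbb F_q^n\to\mathbb C$ the Fourier transform is $\widehat h(x)=\sum_{m\in\mathbb F_q^n}\chi(-m\cdot x)h(m)$ (used with $n=d$ for $g$ and with $n=d+1$ for $\mathcal Sg$). For $g:\mathbb F_q^d\to\mathbb C$, the function $\mathcal Sg:\mathbb F_q^{d+1}\to\mathbb C$ is defined by $\mathcal Sg(m,m_{d+1}):=\frac1q\sum_{t\in\mathbb F_q^*}\chi(tm_{d+1})\,g(tm)$ for $m\in\mathbb F_q^d$, $m_{d+1}\in\mathbb F_q$. For a finite set $V$ and $1\le p<\infty$: $\|f\|_{L^p(V)}:=\big(\frac1{|V|}\sum_{x\in V}|f(x)|^p\big)^{1/p}$ and $\|f\|_{\ell^p(V)}:=\big(\sum_{x\in V}|f(x)|^p\big)^{1/p}$; for $p=\infty$ both are $\max_{x\in V}|f(x)|$. *)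

theory Defs
  imports
    Complex_Main
    "HOL-Library.FuncSet"
    "HOL-Library.Extended_Real"
    "HOL-Algebra.Ring"
    "HOL-Number_Theory.Prime_Powers"
begin

text \<open>
  Fields are HOL-Algebra records, so that a statement can quantify over a family of finite fields
  inside the formula.  A vector of \<open>F\<^sup>n\<close> is an extensional function on \<open>{..<n}\<close>.  A point
  \<open>(x, x\<^sub>d\<^sub>+\<^sub>1)\<close> of \<open>F\<^sup>d \<times> F = F\<^sup>d\<^sup>+\<^sup>1\<close> is a vector whose first \<open>d\<close> coordinates
  (indices \<open>0, \<dots>, d - 1\<close>) form \<open>x\<close> and whose last coordinate \<open>x\<^sub>d\<^sub>+\<^sub>1\<close> has index \<open>d\<close>.
\<close>

definition vecs :: "('a, 'b) ring_scheme \<Rightarrow> nat \<Rightarrow> (nat \<Rightarrow> 'a) set" where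
  "vecs F n = {..<n} \<rightarrow>\<^sub>E carrier F"

definition dotp :: "('a, 'b) ring_scheme \<Rightarrow> nat \<Rightarrow> (nat \<Rightarrow> 'a) \<Rightarrow> (nat \<Rightarrow> 'a) \<Rightarrow> 'a" where
  "dotp F n x y = (\<Oplus>\<^bsub>F\<^esub>i\<in>{..<n}. x i \<otimes>\<^bsub>F\<^esub> y i)"

definition scale :: "('a, 'b) ring_scheme \<Rightarrow> nat \<Rightarrow> 'a \<Rightarrow> (nat \<Rightarrow> 'a) \<Rightarrow> nat \<Rightarrow> 'a" where
  "scale F n t x = (\<lambda>i\<in>{..<n}. t \<otimes>\<^bsub>F\<^esub> x i)"

text \<open>
  \<open>qnorm F n x\<close> only reads the first \<open>n\<close> coordinates of \<open>x\<close>, so \<open>qnorm F d\<close> applies to the \<open>F\<^sup>d\<close>-part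
  of a vector in \<open>F\<^sup>d\<^sup>+\<^sup>1\<close>.
\<close>

definition qnorm :: "('a, 'b) ring_scheme \<Rightarrow> nat \<Rightarrow> (nat \<Rightarrow> 'a) \<Rightarrow> 'a" where
  "qnorm F n x = (\<Oplus>\<^bsub>F\<^esub>i\<in>{..<n}. x i [^]\<^bsub>F\<^esub> (2::nat))"

text \<open>The set \<open>S\<^sub>j\<^sup>d\<^sup>-\<^sup>1\<close> in \<open>F\<^sup>d\<close>.\<close>

definition Sphere :: "('a, 'b) ring_scheme \<Rightarrow> nat \<Rightarrow> 'a \<Rightarrow> (nat \<Rightarrow> 'a) set" where
  "Sphere F d j = {x \<in> vecs F d. qnorm F d x = j}"

text \<open>The set \<open>H\<^sub>j\<^sup>d\<close> in \<open>F\<^sup>d\<^sup>+\<^sup>1\<close>.\<close>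

definition Hvar :: "('a, 'b) ring_scheme \<Rightarrow> nat \<Rightarrow> 'a \<Rightarrow> (nat \<Rightarrow> 'a) set" where
  "Hvar F d j = {x \<in> vecs F (d + 1). qnorm F d x = j \<otimes>\<^bsub>F\<^esub> (x d [^]\<^bsub>F\<^esub> (2::nat))}"

definition additive_character :: "('a, 'b) ring_scheme \<Rightarrow> ('a \<Rightarrow> complex) \<Rightarrow> bool" where
  "additive_character F \<chi> \<longleftrightarrow>
     (\<forall>x\<in>carrier F. cmod (\<chi> x) = 1) \<and>
     (\<forall>x\<in>carrier F. \<forall>y\<in>carrier F. \<chi> (x \<oplus>\<^bsub>F\<^esub> y) = \<chi> x * \<chi> y)"

definition nontrivial_additive_character ::
    "('a, 'b) ring_scheme \<Rightarrow> ('a \<Rightarrow> complex) \<Rightarrow> bool" where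
  "nontrivial_additive_character F \<chi> \<longleftrightarrow>
     additive_character F \<chi> \<and> (\<exists>x\<in>carrier F. \<chi> x \<noteq> 1)"

definition fourier :: "('a, 'b) ring_scheme \<Rightarrow> ('a \<Rightarrow> complex) \<Rightarrow> nat \<Rightarrow>
    ((nat \<Rightarrow> 'a) \<Rightarrow> complex) \<Rightarrow> (nat \<Rightarrow> 'a) \<Rightarrow> complex" where
  "fourier F \<chi> n h x = (\<Sum>m\<in>vecs F n. \<chi> (\<ominus>\<^bsub>F\<^esub> dotp F n m x) * h m)"

text \<open>The operator \<open>\<S>\<close>, taking functions on \<open>F\<^sup>d\<close> to functions on \<open>F\<^sup>d\<^sup>+\<^sup>1\<close>.\<close>

definition Sop :: "('a, 'b) ring_scheme \<Rightarrow> ('a \<Rightarrow> complex) \<Rightarrow> nat \<Rightarrow>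
    ((nat \<Rightarrow> 'a) \<Rightarrow> complex) \<Rightarrow> (nat \<Rightarrow> 'a) \<Rightarrow> complex" where
  "Sop F \<chi> d g m =
     1 / of_nat (card (carrier F)) *
     (\<Sum>t\<in>carrier F - {\<zero>\<^bsub>F\<^esub>}. \<chi> (t \<otimes>\<^bsub>F\<^esub> m d) * g (scale F d t m))"

text \<open>Normalised and counting norms on a finite nonempty set \<open>V\<close>, for \<open>1 \<le> p \<le> \<infinity>\<close>.\<close>

definition Lnorm :: "ereal \<Rightarrow> 'v set \<Rightarrow> ('v \<Rightarrow> complex) \<Rightarrow> real" where
  "Lnorm p V f =
     (if p = \<infinity> then Max ((\<lambda>x. cmod (f x)) ` V)
      else (1 / real (card V) * (\<Sum>x\<in>V. cmod (f x) powr real_of_ereal p))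
             powr (1 / real_of_ereal p))"

definition lnorm :: "ereal \<Rightarrow> 'v set \<Rightarrow> ('v \<Rightarrow> complex) \<Rightarrow> real" where
  "lnorm p V f =
     (if p = \<infinity> then Max ((\<lambda>x. cmod (f x)) ` V)
      else (\<Sum>x\<in>V. cmod (f x) powr real_of_ereal p) powr (1 / real_of_ereal p))"

end

theory Submission
  imports Defs
begin

text \<open>
  By orthogonality of characters, the Fourier transform of \<open>\<S>g\<close> at \<open>(tx, t)\<close> with \<open>t \<noteq> 0\<close> equals
  that of \<open>g\<close> at \<open>x\<close>, and the points \<open>(tx, t)\<close> with \<open>x\<close> in the sphere \<open>S\<close> are exactly the points
  of \<open>H\<close> with nonzero last coordinate.  Hence the norm over \<open>H\<close> dominates the norm over \<open>S\<close> up to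
  a power of \<open>|H| / ((q - 1) |S|)\<close>.  This ratio is at most \<open>5\<close>: the remaining part of \<open>H\<close> is the
  null cone, which has at most \<open>2 q\<^sup>d\<^sup>-\<^sup>1\<close> points, while \<open>|S| \<ge> q\<^sup>d\<^sup>-\<^sup>2\<close> because every element of a
  finite field is a sum of two squares.
\<close>

section \<open>Vectors and the splitting off of the last coordinate\<close>

lemma finite_vecs: "finite (carrier R) \<Longrightarrow> finite (vecs R n)"
  unfolding vecs_def by (simp add: finite_PiE)

lemma card_vecs: "card (vecs R n) = card (carrier R) ^ n"
  unfolding vecs_def by (simp add: card_PiE)

lemma vecs_carrier: "m \<in> vecs R n \<Longrightarrow> i < n \<Longrightarrow> m i \<in> carrier R"
  unfolding vecs_def by (erule PiE_mem) simp

lemma vecs_undefined: "m \<in> vecs R n \<Longrightarrow> \<not> i < n \<Longrightarrow> m i = undefined"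
  unfolding vecs_def by (erule PiE_arb) simp

lemma vecsI:
  "(\<And>i. i < n \<Longrightarrow> m i \<in> carrier R) \<Longrightarrow> (\<And>i. \<not> i < n \<Longrightarrow> m i = undefined) \<Longrightarrow> m \<in> vecs R n"
  unfolding vecs_def by (rule PiE_I) simp_all

lemma vecs_upd:
  assumes "m \<in> vecs R n" "l \<in> carrier R" shows "m(n := l) \<in> vecs R (Suc n)"
  using assms by (intro vecsI) (auto simp: vecs_carrier vecs_undefined less_Suc_eq)

lemma restrict_vecs: "z \<in> vecs R (Suc n) \<Longrightarrow> restrict z {..<n} \<in> vecs R n"
  by (rule vecsI) (simp_all add: vecs_carrier)

lemma restrict_upd_vecs: "m \<in> vecs R n \<Longrightarrow> restrict (m(n := l)) {..<n} = m"
  \<comment> \<open>Beyond the index range both sides are \<open>undefined\<close>; this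
    extensionality is what undoes the update.\<close>
  by (rule ext) (simp add: vecs_undefined restrict_def)

lemma upd_restrict_vecs: "z \<in> vecs R (Suc n) \<Longrightarrow> (restrict z {..<n})(n := z n) = z"
  by (rule ext) (simp add: vecs_undefined restrict_def)

lemma bij_betw_vecs_Suc:
  "bij_betw (\<lambda>(m, l). m(n := l)) (vecs R n \<times> carrier R) (vecs R (Suc n))"
  by (rule bij_betw_byWitness[where f' = "\<lambda>z. (restrict z {..<n}, z n)"])
    (auto simp only: restrict_upd_vecs upd_restrict_vecs vecs_upd restrict_vecs vecs_carrier
      split_conv fun_upd_same mem_Sigma_iff lessI)

lemma vecs_Suc_cases:
  assumes "z \<in> vecs R (Suc n)"
  obtains m l where "m \<in> vecs R n" "l \<in> carrier R" "z = m(n := l)"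
  using assms upd_restrict_vecs restrict_vecs vecs_carrier[OF _ lessI] by metis

lemma vecs_upd_inj:
  assumes "m \<in> vecs R n" "m' \<in> vecs R n" "m(n := l) = m'(n := l')"
  shows "m = m' \<and> l = l'"
  using assms restrict_upd_vecs fun_upd_same by metis

lemma sum_vecs_Suc:
  "(\<Sum>z\<in>vecs R (Suc n). f z) = (\<Sum>m\<in>vecs R n. \<Sum>l\<in>carrier R. f (m(n := l)))"
proof -
  have "(\<Sum>z\<in>vecs R (Suc n). f z) = (\<Sum>(m, l)\<in>vecs R n \<times> carrier R. f (m(n := l)))"
    by (subst sum.reindex_bij_betw[OF bij_betw_vecs_Suc, symmetric])
      (simp add: case_prod_unfold)
  then show ?thesis by (simp add: sum.cartesian_product)
qed

text \<open>\<open>scale R n\<close> reads only the coordinates below \<open>n\<close>. Hence, in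
  \<open>Sop\<close> at a point \<open>m(d := l)\<close>, the last coordinate \<open>l\<close>
  enters through the character alone.\<close>

lemma scale_upd [simp]: "scale R n t (m(n := l)) = scale R n t m"
  by (auto simp: scale_def)

section \<open>Dot product, quadratic form and scaling over a field\<close>

context field
begin

lemma minus_eq_zero_iff:
  assumes "x \<in> carrier R" "y \<in> carrier R"
  shows "x \<ominus> y = \<zero> \<longleftrightarrow> x = y"
proof
  assume "x \<ominus> y = \<zero>"
  then have "x = \<ominus> (\<ominus> y)" using assms by (intro sum_zero_eq_neg) (auto simp: minus_eq)
  then show "x = y" using assms by simp
qed (use assms in \<open>simp add: minus_eq r_neg\<close>)

lemma dotp_closed:
  "x \<in> vecs R n \<Longrightarrow> y \<in> vecs R n \<Longrightarrow> dotp R n x y \<in> carrier R"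
  unfolding dotp_def by (auto intro!: finsum_closed simp: vecs_carrier)

lemma qnorm_closed: "x \<in> vecs R n \<Longrightarrow> qnorm R n x \<in> carrier R"
  unfolding qnorm_def by (auto intro!: finsum_closed simp: vecs_carrier)

lemma dotp_upd:
  assumes "m \<in> vecs R n" "x \<in> vecs R n" "l \<in> carrier R" "t \<in> carrier R"
  shows "dotp R (Suc n) (m(n := l)) (x(n := t)) = dotp R n m x \<oplus> l \<otimes> t"
proof -
  have "dotp R (Suc n) (m(n := l)) (x(n := t)) = l \<otimes> t \<oplus>
      (\<Oplus>i\<in>{..<n}. (m(n := l)) i \<otimes> (x(n := t)) i)"
    unfolding dotp_def lessThan_Suc
    using assms by (subst finsum_insert) (auto simp: vecs_carrier)
  also have "(\<Oplus>i\<in>{..<n}. (m(n := l)) i \<otimes> (x(n := t)) i) = dotp R n m x"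
    unfolding dotp_def using assms by (intro finsum_cong') (auto simp: vecs_carrier)
  finally show ?thesis
    using a_comm[OF m_closed[OF assms(3,4)] dotp_closed[OF assms(1,2)]] by (rule trans)
qed

lemma qnorm_upd_eq:
  assumes "m \<in> vecs R n" "l \<in> carrier R"
  shows "qnorm R n (m(n := l)) = qnorm R n m"
  unfolding qnorm_def using assms by (intro finsum_cong') (auto simp: vecs_carrier)

lemma qnorm_upd:
  assumes "m \<in> vecs R n" "l \<in> carrier R"
  shows "qnorm R (Suc n) (m(n := l)) = qnorm R n m \<oplus> l [^] (2::nat)"
proof -
  have "qnorm R (Suc n) (m(n := l)) = l [^] (2::nat) \<oplus> qnorm R n (m(n := l))"
    unfolding qnorm_def lessThan_Suc
    using assms by (subst finsum_insert) (auto simp: vecs_carrier)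
  then show ?thesis
    using assms by (simp add: qnorm_upd_eq a_comm qnorm_closed)
qed

lemma scale_vecs: "x \<in> vecs R n \<Longrightarrow> t \<in> carrier R \<Longrightarrow> scale R n t x \<in> vecs R n"
  by (auto simp: scale_def vecs_def)

lemma scale_scale:
  assumes "x \<in> vecs R n" "s \<in> carrier R" "t \<in> carrier R"
  shows "scale R n s (scale R n t x) = scale R n (s \<otimes> t) x"
  using assms by (auto simp: scale_def fun_eq_iff vecs_carrier m_assoc)

lemma scale_one: "x \<in> vecs R n \<Longrightarrow> scale R n \<one> x = x"
  by (auto simp: scale_def vecs_def fun_eq_iff PiE_iff extensional_def)

text \<open>Scaling is self-adjoint for the dot product. This moves \<open>t\<close> from the
  frequency to the summation variable, where the substitution by \<open>scale R n t\<close> absorbs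
  it.\<close>

lemma dotp_scale:
  assumes "x \<in> vecs R n" "m \<in> vecs R n" "t \<in> carrier R"
  shows "dotp R n m (scale R n t x) = dotp R n (scale R n t m) x"
  unfolding dotp_def using assms
  by (intro finsum_cong') (auto simp: scale_def vecs_carrier m_ac)

lemma qnorm_scale:
  assumes "x \<in> vecs R n" "t \<in> carrier R"
  shows "qnorm R n (scale R n t x) = t [^] (2::nat) \<otimes> qnorm R n x"
  unfolding qnorm_def using assms
  by (subst finsum_rdistr)
    (auto intro!: finsum_cong' simp: scale_def vecs_carrier nat_pow_distrib)

lemma inv_closed: "t \<in> carrier R - {\<zero>} \<Longrightarrow> inv t \<in> carrier R - {\<zero>}"
  using field_Units Units_inv_Units by auto

lemma mult_inv_cancel:
  assumes "t \<in> carrier R - {\<zero>}"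
  shows "t \<otimes> inv t = \<one>" "inv t \<otimes> t = \<one>"
  using assms field_Units by (auto simp: Units_r_inv Units_l_inv)

lemma bij_betw_scale:
  assumes "t \<in> carrier R - {\<zero>}"
  shows "bij_betw (scale R n t) (vecs R n) (vecs R n)"
  by (rule bij_betw_byWitness[where f' = "scale R n (inv t)"])
    (use assms inv_closed[OF assms] mult_inv_cancel[OF assms]
      in \<open>auto simp: scale_vecs scale_scale scale_one\<close>)

section \<open>Orthogonality of characters and the Fourier transform of \<open>Sop\<close>\<close>

lemma additive_character_zero: "additive_character R \<chi> \<Longrightarrow> \<chi> \<zero> = 1"
proof -
  assume *: "additive_character R \<chi>"
  then have "cmod (\<chi> \<zero>) = 1" "\<chi> (\<zero> \<oplus> \<zero>) = \<chi> \<zero> * \<chi> \<zero>"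
    unfolding additive_character_def by blast+
  \<comment> \<open>The value is idempotent, hence 0 or 1, and modulus 1 excludes 0.\<close>
  then show ?thesis by auto
qed

text \<open>For \<open>y \<noteq> \<zero>\<close>, pick \<open>a\<close> with
  \<open>\<chi> a \<noteq> 1\<close> and \<open>b\<close> with \<open>b \<otimes> y = a\<close>.
  Shifting \<open>l\<close> by \<open>b\<close> permutes the field and multiplies the sum by
  \<open>\<chi> a\<close>, so the sum vanishes.\<close>

lemma sum_character:
  assumes "finite (carrier R)" "nontrivial_additive_character R \<chi>" "y \<in> carrier R"
  shows "(\<Sum>l\<in>carrier R. \<chi> (l \<otimes> y)) = (if y = \<zero> then of_nat (card (carrier R)) else 0)"
proof (cases "y = \<zero>")
  case True
  then show ?thesis
    using assms(2) additive_character_zero unfolding nontrivial_additive_character_def by simp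
next
  case False
  obtain a where a: "a \<in> carrier R" "\<chi> a \<noteq> 1" and add:
    "\<And>x y. x \<in> carrier R \<Longrightarrow> y \<in> carrier R \<Longrightarrow> \<chi> (x \<oplus> y) = \<chi> x * \<chi> y"
    using assms(2) unfolding nontrivial_additive_character_def additive_character_def by blast
  define b where "b = a \<otimes> inv y"
  have y: "y \<in> carrier R - {\<zero>}" using False assms(3) by simp
  have b: "b \<in> carrier R" "b \<otimes> y = a"
    using a y inv_closed[OF y] mult_inv_cancel[OF y] by (auto simp: b_def m_assoc)
  have "bij_betw (\<lambda>l. l \<oplus> b) (carrier R) (carrier R)"
    by (rule bij_betw_byWitness[where f' = "\<lambda>l. l \<oplus> \<ominus> b"])
      (use b in \<open>auto simp: a_assoc r_neg l_neg\<close>)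
  then have "(\<Sum>l\<in>carrier R. \<chi> (l \<otimes> y)) = (\<Sum>l\<in>carrier R. \<chi> ((l \<oplus> b) \<otimes> y))"
    by (rule sum.reindex_bij_betw[symmetric])
  also have "\<dots> = (\<Sum>l\<in>carrier R. \<chi> (l \<otimes> y) * \<chi> a)"
    using assms(3) b a by (intro sum.cong) (auto simp: l_distr add)
  also have "\<dots> = (\<Sum>l\<in>carrier R. \<chi> (l \<otimes> y)) * \<chi> a"
    by (simp add: sum_distrib_right)
  finally show ?thesis using a False by simp
qed

text \<open>Summing over the last coordinate \<open>l\<close> first keeps only the term
  \<open>u = t\<close> of the sum defining \<open>Sop\<close>. The substitution of
  \<open>scale R d t m\<close> for \<open>m\<close> then turns the frequency
  \<open>scale R d t x\<close> back into \<open>x\<close>.\<close>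

lemma fourier_Sop:
  assumes fin: "finite (carrier R)" and \<chi>: "nontrivial_additive_character R \<chi>"
    and t: "t \<in> carrier R - {\<zero>}" and x: "x \<in> vecs R d"
  shows "fourier R \<chi> (Suc d) (Sop R \<chi> d g) ((scale R d t x)(d := t)) = fourier R \<chi> d g x"
proof -
  define q where "q = (of_nat (card (carrier R)) :: complex)"
  have q: "q \<noteq> 0" using fin zero_closed by (auto simp: q_def)
  have add: "\<chi> (x \<oplus> y) = \<chi> x * \<chi> y" if "x \<in> carrier R" "y \<in> carrier R" for x y
    using \<chi> that unfolding nontrivial_additive_character_def additive_character_def by blast
  let ?U = "carrier R - {\<zero>}"
  let ?e = "\<lambda>m. \<chi> (\<ominus> dotp R d m (scale R d t x))"
  \<comment> \<open>All dependence on \<open>l\<close> is collected into a single character value,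
    so that orthogonality applies to the sum over \<open>l\<close>.\<close>
  have chi: "\<chi> (\<ominus> dotp R (Suc d) (m(d := l)) ((scale R d t x)(d := t))) * \<chi> (u \<otimes> l)
      = ?e m * \<chi> (l \<otimes> (u \<ominus> t))"
    if "m \<in> vecs R d" "l \<in> carrier R" "u \<in> carrier R" for m l u
  proof -
    let ?D = "dotp R d m (scale R d t x)"
    have D: "?D \<in> carrier R" using that x t by (auto intro!: dotp_closed scale_vecs)
    have "\<ominus> (?D \<oplus> l \<otimes> t) \<oplus> u \<otimes> l = \<ominus> ?D \<oplus> l \<otimes> (u \<ominus> t)"
      using D that t by (simp add: minus_add r_distr r_minus minus_eq a_ac m_comm)
    then show ?thesis
      using D that t x by (simp add: dotp_upd scale_vecs add[symmetric])
  qed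
  have diff0: "u \<ominus> t = \<zero> \<longleftrightarrow> u = t" if "u \<in> carrier R" for u
    using that t by (simp add: minus_eq_zero_iff)
  have "fourier R \<chi> (Suc d) (Sop R \<chi> d g) ((scale R d t x)(d := t))
      = (\<Sum>m\<in>vecs R d. \<Sum>l\<in>carrier R. \<Sum>u\<in>?U.
          1 / q * g (scale R d u m) *
            (\<chi> (\<ominus> dotp R (Suc d) (m(d := l)) ((scale R d t x)(d := t))) * \<chi> (u \<otimes> l)))"
    unfolding fourier_def sum_vecs_Suc Sop_def q_def
    by (simp add: sum_distrib_left sum_divide_distrib mult_ac)
  also have "\<dots> = (\<Sum>m\<in>vecs R d. \<Sum>l\<in>carrier R. \<Sum>u\<in>?U.
          1 / q * g (scale R d u m) * (?e m * \<chi> (l \<otimes> (u \<ominus> t))))"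
    by (intro sum.cong refl) (simp add: chi del: scale_upd)
  also have "\<dots> = (\<Sum>m\<in>vecs R d. \<Sum>u\<in>?U. \<Sum>l\<in>carrier R.
          1 / q * g (scale R d u m) * (?e m * \<chi> (l \<otimes> (u \<ominus> t))))"
    by (intro sum.cong refl sum.swap)
  also have "\<dots> = (\<Sum>m\<in>vecs R d. \<Sum>u\<in>?U.
          1 / q * g (scale R d u m) * ?e m * (\<Sum>l\<in>carrier R. \<chi> (l \<otimes> (u \<ominus> t))))"
    by (simp add: sum_distrib_left mult.assoc)
  \<comment> \<open>For \<open>u = t\<close> the inner sum is \<open>q\<close>, which cancels the
    factor \<open>1 / q\<close> of \<open>Sop\<close>; for every other \<open>u\<close> it is
    0.\<close>
  also have "\<dots> = (\<Sum>m\<in>vecs R d. \<Sum>u\<in>?U.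
          if u = t then g (scale R d u m) * ?e m else 0)"
    using q t by (intro sum.cong refl) (auto simp: sum_character[OF fin \<chi>] diff0 q_def[symmetric])
  \<comment> \<open>The index \<open>u = t\<close> does occur in the range \<open>?U\<close>,
    because \<open>t \<noteq> \<zero>\<close>.\<close>
  also have "\<dots> = (\<Sum>m\<in>vecs R d. g (scale R d t m) * ?e m)"
    using t fin by (intro sum.cong refl) (simp add: sum.delta')
  also have "\<dots> = (\<Sum>m\<in>vecs R d. \<chi> (\<ominus> dotp R d (scale R d t m) x) * g (scale R d t m))"
    using t x by (intro sum.cong refl) (simp add: dotp_scale)
  also have "\<dots> = fourier R \<chi> d g x"
    unfolding fourier_def by (rule sum.reindex_bij_betw[OF bij_betw_scale[OF t]])
  finally show ?thesis .
qed

section \<open>Counting squares, the null cone and the sphere\<close>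

lemma card_square_roots_le:
  assumes "finite (carrier R)"
  shows "card {v \<in> carrier R. v [^] (2::nat) = c} \<le> 2"
proof (cases "\<exists>w \<in> carrier R. w [^] (2::nat) = c")
  case True
  then obtain w where w: "w \<in> carrier R" "w [^] (2::nat) = c" by blast
  \<comment> \<open>The difference of the squares factors as
    \<open>(v \<ominus> w) \<otimes> (v \<oplus> w)\<close>, and a field has no zero divisors. The
    two roots may coincide, as in characteristic 2.\<close>
  have "{v \<in> carrier R. v [^] (2::nat) = c} \<subseteq> {w, \<ominus> w}"
  proof
    fix v assume "v \<in> {v \<in> carrier R. v [^] (2::nat) = c}"
    then have v: "v \<in> carrier R" "v [^] (2::nat) = c" by simp_all
    have "v \<otimes> v = w \<otimes> w" using v w by (simp add: numeral_2_eq_2)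
    then have "(v \<ominus> w) \<otimes> (v \<oplus> w) = \<zero>"
      using v(1) w(1) by algebra
    then have "v \<ominus> w = \<zero> \<or> v \<oplus> w = \<zero>"
      using v w by (intro integral) auto
    then show "v \<in> {w, \<ominus> w}"
      using v w minus_eq_zero_iff sum_zero_eq_neg by blast
  qed
  then have "card {v \<in> carrier R. v [^] (2::nat) = c} \<le> card {w, \<ominus> w}"
    by (intro card_mono) auto
  also have "\<dots> \<le> 2" by (simp add: card_insert_if)
  finally show ?thesis .
next
  case False
  then have "{v \<in> carrier R. v [^] (2::nat) = c} = {}" by blast
  then show ?thesis by (simp only: card.empty)
qed

text \<open>Zero has one square root and every other square at most two. Summing over the fibres of
  squaring gives at most \<open>1 + 2 * (b - 1)\<close> elements, where \<open>b\<close> is the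
  number of squares. The single root of zero makes the bound strict, in every
  characteristic.\<close>

lemma card_carrier_less_squares:
  assumes fin: "finite (carrier R)"
  shows "card (carrier R) < 2 * card ((\<lambda>v. v [^] (2::nat)) ` carrier R)"
proof -
  let ?sq = "\<lambda>v. v [^] (2::nat)"
  let ?B = "?sq ` carrier R"
  have z: "\<zero> \<in> ?B" by (rule image_eqI[of _ _ "\<zero>"]) (auto simp: numeral_2_eq_2)
  have finB: "finite ?B" using fin by simp
  have "card (carrier R) = (\<Sum>c\<in>?B. card {v \<in> carrier R. ?sq v = c})"
    using sum.image_gen[OF fin, of "\<lambda>_. 1::nat" ?sq] by simp
  also have "\<dots> = card {v \<in> carrier R. ?sq v = \<zero>}
      + (\<Sum>c\<in>?B - {\<zero>}. card {v \<in> carrier R. ?sq v = c})"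
    using z finB by (simp add: sum.remove)
  also have "{v \<in> carrier R. ?sq v = \<zero>} = {\<zero>}"
    by (auto simp: numeral_2_eq_2 integral_iff)
  also have "(\<Sum>c\<in>?B - {\<zero>}. card {v \<in> carrier R. ?sq v = c}) \<le> (\<Sum>c\<in>?B - {\<zero>}. 2)"
    by (intro sum_mono card_square_roots_le fin)
  \<comment> \<open>The set \<open>?B\<close> is nonempty, so the natural number subtraction
    \<open>card ?B - 1\<close> does not truncate.\<close>
  finally show ?thesis
    using z finB card_gt_0_iff[of ?B] by (simp add: card_Diff_singleton) force
qed

text \<open>Pigeonhole: the squares and their reflections \<open>c \<ominus> v\<close> each fill
  more than half of the field, so the two sets meet.\<close>

lemma sum_of_two_squares:
  assumes fin: "finite (carrier R)" and c: "c \<in> carrier R"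
  obtains a b where "a \<in> carrier R" "b \<in> carrier R" "a [^] (2::nat) \<oplus> b [^] (2::nat) = c"
proof -
  let ?B = "(\<lambda>v. v [^] (2::nat)) ` carrier R"
  let ?C = "(\<lambda>v. c \<ominus> v) ` ?B"
  have sub: "?B \<subseteq> carrier R" "?C \<subseteq> carrier R" using c by auto
  have inj: "inj_on (\<lambda>v. c \<ominus> v) ?B"
  proof (rule inj_onI)
    fix u v assume "u \<in> ?B" "v \<in> ?B" "c \<ominus> u = c \<ominus> v"
    then have "u \<in> carrier R" "v \<in> carrier R" "\<ominus> u = \<ominus> v"
      using c sub(1) by (auto simp: minus_eq)
    then show "u = v" by (metis minus_minus)
  qed
  have "?B \<inter> ?C \<noteq> {}"
  proof
    assume "?B \<inter> ?C = {}"
    then have "card ?B + card ?C = card (?B \<union> ?C)"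
      using fin by (intro card_Un_disjoint[symmetric]) auto
    also have "\<dots> \<le> card (carrier R)" using fin sub by (intro card_mono) auto
    finally show False
      using card_carrier_less_squares[OF fin] card_image[OF inj] by simp
  qed
  then obtain a b where ab: "a \<in> carrier R" "b \<in> carrier R"
    "a [^] (2::nat) = c \<ominus> b [^] (2::nat)" by blast
  have "a [^] (2::nat) \<oplus> b [^] (2::nat) = c"
    unfolding ab(3) using ab c by (simp add: minus_eq a_assoc l_neg)
  with ab show ?thesis using that by blast
qed

text \<open>Once the first \<open>n\<close> coordinates are chosen, the square of the last one is
  determined, which leaves at most two values for it.\<close>

lemma card_null_cone_le:
  assumes fin: "finite (carrier R)"
  shows "card {x \<in> vecs R (Suc n). qnorm R (Suc n) x = \<zero>} \<le> 2 * card (carrier R) ^ n"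
proof -
  let ?N = "{x \<in> vecs R (Suc n). qnorm R (Suc n) x = \<zero>}"
  let ?T = "SIGMA y:vecs R n. {v \<in> carrier R. v [^] (2::nat) = \<ominus> qnorm R n y}"
  have finT: "finite ?T" using fin by (intro finite_SigmaI finite_vecs) auto
  have "?N \<subseteq> (\<lambda>(y, v). y(n := v)) ` ?T"
  proof
    fix x assume x: "x \<in> ?N"
    then obtain y v where yv: "y \<in> vecs R n" "v \<in> carrier R" "x = y(n := v)"
      by (auto elim: vecs_Suc_cases)
    then have "v [^] (2::nat) \<oplus> qnorm R n y = \<zero>"
      using x by (simp add: qnorm_upd a_comm qnorm_closed)
    then have "v [^] (2::nat) = \<ominus> qnorm R n y"
      using yv by (simp add: minus_equality qnorm_closed)
    then show "x \<in> (\<lambda>(y, v). y(n := v)) ` ?T" using yv by force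
  qed
  then have "card ?N \<le> card ?T"
    using finT by (rule surj_card_le[rotated])
  also have "\<dots> = (\<Sum>y\<in>vecs R n. card {v \<in> carrier R. v [^] (2::nat) = \<ominus> qnorm R n y})"
    using fin by (intro card_SigmaI finite_vecs) auto
  also have "\<dots> \<le> (\<Sum>y\<in>vecs R n. 2)"
    by (intro sum_mono card_square_roots_le fin)
  finally show ?thesis by (simp add: card_vecs mult.commute)
qed

text \<open>The first \<open>n\<close> coordinates are free: the last two can always be chosen so
  that their squares sum to what is missing from \<open>c\<close>.\<close>

lemma card_Sphere_ge:
  assumes fin: "finite (carrier R)" and c: "c \<in> carrier R"
  shows "card (carrier R) ^ n \<le> card (Sphere R (Suc (Suc n)) c)"
proof -
  have "\<exists>a b. a \<in> carrier R \<and> b \<in> carrier R \<and> a [^] (2::nat) \<oplus> b [^] (2::nat) = c \<ominus> qnorm R n y"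
    if "y \<in> vecs R n" for y
    using that c by (metis sum_of_two_squares[OF fin] minus_closed qnorm_closed)
  then obtain a b where ab: "\<And>y. y \<in> vecs R n \<Longrightarrow> a y \<in> carrier R \<and> b y \<in> carrier R \<and>
      a y [^] (2::nat) \<oplus> b y [^] (2::nat) = c \<ominus> qnorm R n y" by metis
  let ?f = "\<lambda>y. (y(n := a y))(Suc n := b y)"
  have f: "?f ` vecs R n \<subseteq> Sphere R (Suc (Suc n)) c"
  proof safe
    fix y assume y: "y \<in> vecs R n"
    note yab = ab[OF y]
    have "qnorm R (Suc (Suc n)) (?f y) = qnorm R n y \<oplus> (a y [^] (2::nat) \<oplus> b y [^] (2::nat))"
      using y yab by (simp add: qnorm_upd vecs_upd a_assoc qnorm_closed)
    also have "\<dots> = c" using y yab c qnorm_closed[OF y]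
      by (simp add: minus_eq a_lcomm[of _ c] r_neg)
    finally show "?f y \<in> Sphere R (Suc (Suc n)) c"
      using y yab by (simp add: Sphere_def vecs_upd)
  qed
  \<comment> \<open>Stripping the two appended coordinates recovers \<open>y\<close>, whatever
    choices \<open>a\<close> and \<open>b\<close> make.\<close>
  have inj: "inj_on ?f (vecs R n)"
    by (rule inj_onI) (metis ab vecs_upd vecs_upd_inj)
  have "finite (Sphere R (Suc (Suc n)) c)"
    using finite_vecs[OF fin] by (simp add: Sphere_def)
  then have "card (?f ` vecs R n) \<le> card (Sphere R (Suc (Suc n)) c)"
    using f by (rule card_mono)
  then show ?thesis by (simp add: card_image[OF inj] card_vecs)
qed

section \<open>\<open>Hvar\<close> as a punctured cone over the sphere together with the null
  cone\<close>

lemma cone_point_in_Hvar: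
  assumes "t \<in> carrier R" "x \<in> Sphere R d c" "c \<in> carrier R"
  shows "(scale R d t x)(d := t) \<in> Hvar R d c"
  using assms
  by (simp add: Hvar_def Sphere_def vecs_upd scale_vecs qnorm_upd_eq qnorm_scale m_comm)

text \<open>The last coordinate gives back \<open>t\<close>, and scaling by a nonzero
  \<open>t\<close> is injective.\<close>

lemma cone_points_inj:
  "inj_on (\<lambda>(t, x). (scale R d t x)(d := t)) ((carrier R - {\<zero>}) \<times> Sphere R d c)"
    (is "inj_on ?f ?D")
proof (rule inj_onI)
  fix p p' assume p: "p \<in> ?D" "p' \<in> ?D" "?f p = ?f p'"
  obtain t x t' x' where tx: "p = (t, x)" "p' = (t', x')" by fastforce
  have *: "t \<in> carrier R" "t \<noteq> \<zero>" "t' \<in> carrier R" "x \<in> Sphere R d c" "x' \<in> Sphere R d c"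
    "(scale R d t x)(d := t) = (scale R d t' x')(d := t')"
    using p unfolding tx mem_Sigma_iff split_conv by blast+
  then have x: "x \<in> vecs R d" "x' \<in> vecs R d" by (auto simp: Sphere_def)
  then have "scale R d t x = scale R d t' x'" and t: "t = t'"
    using * vecs_upd_inj[OF scale_vecs scale_vecs] by blast+
  then have "x = x'"
    using x * bij_betw_scale[of t d] by (auto simp: bij_betw_def dest: inj_onD)
  with t show "p = p'" by (simp add: tx)
qed

text \<open>A point \<open>(m, t)\<close> with \<open>t \<noteq> \<zero>\<close> comes from
  \<open>m\<close> scaled by \<open>inv t\<close>, since the factor \<open>inv t\<close> squared
  cancels the square of \<open>t\<close> in the equation of \<open>Hvar\<close>. For
  \<open>t = \<zero>\<close> that equation says that \<open>m\<close> is null.\<close>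

lemma Hvar_subset:
  assumes c: "c \<in> carrier R"
  shows "Hvar R d c \<subseteq> (\<lambda>(t, x). (scale R d t x)(d := t)) ` ((carrier R - {\<zero>}) \<times> Sphere R d c)
    \<union> (\<lambda>x. x(d := \<zero>)) ` {x \<in> vecs R d. qnorm R d x = \<zero>}"
    (is "_ \<subseteq> ?A \<union> ?B")
proof
  fix z assume "z \<in> Hvar R d c"
  then obtain m t where m: "m \<in> vecs R d" "t \<in> carrier R" "z = m(d := t)"
    and n: "qnorm R d m = c \<otimes> t [^] (2::nat)"
    by (auto simp: Hvar_def qnorm_upd_eq elim!: vecs_Suc_cases)
  show "z \<in> ?A \<union> ?B"
  proof (cases "t = \<zero>")
    case True
    then have "qnorm R d m = \<zero>" using n c by (simp add: numeral_2_eq_2)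
    then show ?thesis using m True by auto
  next
    case False
    then have t: "t \<in> carrier R - {\<zero>}" using m by simp
    let ?x = "scale R d (inv t) m"
    have "inv t [^] (2::nat) \<otimes> t [^] (2::nat) = \<one>"
      using inv_closed[OF t] t
      by (simp add: nat_pow_distrib[symmetric] mult_inv_cancel)
    then have "qnorm R d ?x = c"
      using m c inv_closed[OF t] by (simp add: qnorm_scale n m_lcomm)
    then have "?x \<in> Sphere R d c"
      using m inv_closed[OF t] by (simp add: Sphere_def scale_vecs)
    moreover have "z = (scale R d t ?x)(d := t)"
      using m inv_closed[OF t] by (simp add: scale_scale mult_inv_cancel[OF t] scale_one)
    ultimately show ?thesis using t by force
  qed
qed

lemma card_Hvar_le:
  assumes fin: "finite (carrier R)" and c: "c \<in> carrier R" and d: "d \<ge> 2"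
  shows "card (Hvar R d c) \<le> 5 * (card (carrier R - {\<zero>}) * card (Sphere R d c))"
proof -
  let ?q = "card (carrier R)" and ?S = "Sphere R d c"
  let ?N = "{x \<in> vecs R d. qnorm R d x = \<zero>}"
  define n where "n = d - 2"
  have n: "d = Suc (Suc n)" using d by (simp add: n_def)
  have finS: "finite ?S" and finN: "finite ?N"
    using finite_vecs[OF fin] by (simp_all add: Sphere_def)
  have U: "card (carrier R - {\<zero>}) = ?q - 1" by (simp add: card_Diff_singleton)
  have "card {\<zero>, \<one>} \<le> ?q" using fin by (intro card_mono) auto
  then have q: "?q \<ge> 2" using zero_not_one by simp
  have finUS: "finite ((carrier R - {\<zero>}) \<times> ?S)" using fin finS by simp
  have "card (Hvar R d c) \<le> card ((\<lambda>(t, x). (scale R d t x)(d := t)) ` ((carrier R - {\<zero>}) \<times> ?S)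
      \<union> (\<lambda>x. x(d := \<zero>)) ` ?N)"
    using finUS finN by (intro card_mono Hvar_subset[OF c]) simp
  also have "\<dots> \<le> card ((carrier R - {\<zero>}) \<times> ?S) + card ?N"
    by (rule order_trans[OF card_Un_le add_mono[OF card_image_le card_image_le]])
      (rule finUS finN)+
  also have "\<dots> = (?q - 1) * card ?S + card ?N"
    by (simp only: card_cartesian_product U)
  finally have H: "card (Hvar R d c) \<le> (?q - 1) * card ?S + card ?N" .
  have "card ?N \<le> 2 * ?q ^ Suc n"
    unfolding n by (rule card_null_cone_le[OF fin])
  also have "\<dots> = 2 * (?q * ?q ^ n)" by simp
  \<comment> \<open>From \<open>?q \<ge> 2\<close> follows \<open>?q \<le> 2 * (?q - 1)\<close>, and
    the sphere has at least \<open>?q ^ n\<close> points. The null cone thus contributes a factor 4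
    and the punctured cone a factor 1, together 5.\<close>
  also have "\<dots> \<le> 2 * ((2 * (?q - 1)) * card ?S)"
    using q card_Sphere_ge[OF fin c, of n, folded n] by (intro mult_left_mono mult_mono) auto
  also have "\<dots> = 4 * ((?q - 1) * card ?S)" by simp
  finally show ?thesis using H unfolding U by linarith
qed

section \<open>Comparison of the norms over the sphere and over \<open>Hvar\<close>\<close>

lemma Sphere_nonempty:
  assumes fin: "finite (carrier R)" and c: "c \<in> carrier R" and d: "d \<ge> 2"
  shows "Sphere R d c \<noteq> {}"
proof
  assume "Sphere R d c = {}"
  moreover have "d = Suc (Suc (d - 2))" using d by simp
  moreover have "card (carrier R) > 0" using fin by (auto simp: card_gt_0_iff)
  ultimately show False using card_Sphere_ge[OF fin c, of "d - 2"] by simp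
qed

text \<open>The transform of \<open>Sop\<close> is constant in \<open>t\<close> along the points
  \<open>(tx, t)\<close>. For \<open>r = \<infinity>\<close> the slice \<open>t = \<one>\<close>
  suffices. For finite \<open>r\<close> every value on the sphere recurs \<open>q - 1\<close> times
  on \<open>Hvar\<close>, and the cardinality bound compares the averages.\<close>

lemma Lnorm_Sphere_le_Hvar:
  assumes fin: "finite (carrier R)" and c: "c \<in> carrier R" and d: "d \<ge> 2" and r: "1 \<le> r"
    and \<chi>: "nontrivial_additive_character R \<chi>"
  shows "Lnorm r (Sphere R d c) (fourier R \<chi> d g)
    \<le> 5 * Lnorm r (Hvar R d c) (fourier R \<chi> (d + 1) (Sop R \<chi> d g))"
proof -
  let ?S = "Sphere R d c" and ?H = "Hvar R d c" and ?U = "carrier R - {\<zero>}"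
  let ?g = "fourier R \<chi> d g" and ?G = "fourier R \<chi> (d + 1) (Sop R \<chi> d g)"
  let ?\<phi> = "\<lambda>(t, x). (scale R d t x)(d := t)"
  have G: "?G ((scale R d t x)(d := t)) = ?g x" if "t \<in> ?U" "x \<in> ?S" for t x
    using that by (simp add: fourier_Sop[OF fin \<chi>] Sphere_def)
  have sub: "?\<phi> ` (?U \<times> ?S) \<subseteq> ?H" using cone_point_in_Hvar c by auto
  have finS: "finite ?S" and finH: "finite ?H"
    using finite_vecs[OF fin] by (simp_all add: Sphere_def Hvar_def)
  \<comment> \<open>This makes \<open>Max\<close> meaningful in the case
    \<open>r = \<infinity>\<close> and the cardinalities positive in the other case.\<close>
  have Sne: "?S \<noteq> {}" by (rule Sphere_nonempty[OF fin c d])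
  have one: "\<one> \<in> ?U" by simp
  show ?thesis
  proof (cases "r = \<infinity>")
    case True
    have "cmod (?g x) \<le> Max ((\<lambda>x. cmod (?G x)) ` ?H)" if x: "x \<in> ?S" for x
    proof -
      have "(scale R d \<one> x)(d := \<one>) \<in> ?H" using cone_point_in_Hvar[OF _ x c] by simp
      then show ?thesis
        using finH unfolding G[OF one x, symmetric] by (intro Max_ge) auto
    qed
    then have "Lnorm r ?S ?g \<le> Lnorm r ?H ?G"
      using finS Sne unfolding Lnorm_def by (simp add: True)
    \<comment> \<open>Here the constant is 1; nonnegativity allows weakening it to the common
      constant 5.\<close>
    moreover have "0 \<le> Lnorm r ?S ?g"
    proof -
      obtain x where "x \<in> ?S" using Sne by blast
      then have "cmod (?g x) \<le> Lnorm r ?S ?g"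
        unfolding Lnorm_def using finS True by (auto intro: Max_ge)
      then show ?thesis by (meson norm_ge_zero order_trans)
    qed
    ultimately show ?thesis by simp
  next
    case False
    define R' where "R' = real_of_ereal r"
    have R': "R' \<ge> 1" using r False by (cases r) (auto simp: R'_def)
    let ?u = "real (card ?U)" and ?s = "real (card ?S)" and ?h = "real (card ?H)"
    let ?A = "\<Sum>x\<in>?S. cmod (?g x) powr R'" and ?B = "\<Sum>z\<in>?H. cmod (?G z) powr R'"
    have u0: "?u > 0" using one fin
      unfolding of_nat_0_less_iff card_gt_0_iff by blast
    have s0: "?s > 0" using Sne finS by (simp add: card_gt_0_iff)
    have "?\<phi> ` (?U \<times> ?S) \<noteq> {}" using one Sne by blast
    then have "?H \<noteq> {}" using sub by blast
    then have h0: "?h > 0" using finH by (simp add: card_gt_0_iff)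
    \<comment> \<open>The sphere sum is repeated once for each \<open>t\<close> and carried over to
      the punctured cone; the rest of \<open>?H\<close> adds only nonnegative terms.\<close>
    have "?u * ?A = (\<Sum>t\<in>?U. ?A)" by (simp only: sum_constant)
    also have "\<dots> = (\<Sum>(t, x)\<in>?U \<times> ?S. cmod (?g x) powr R')"
      by (rule sum.cartesian_product)
    also have "\<dots> = (\<Sum>p\<in>?U \<times> ?S. cmod (?G (?\<phi> p)) powr R')"
      by (intro sum.cong refl) (simp only: mem_Sigma_iff split_paired_all split_conv G)
    also have "\<dots> = (\<Sum>z\<in>?\<phi> ` (?U \<times> ?S). cmod (?G z) powr R')"
      by (rule sum.reindex_cong[OF cone_points_inj refl, symmetric]) auto
    also have "\<dots> \<le> ?B" by (rule sum_mono2[OF finH sub]) auto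
    finally have uA: "?u * ?A \<le> ?B" .
    have "?h \<le> real (5 * (card ?U * card ?S))"
      using card_Hvar_le[OF fin c d] by (rule of_nat_mono)
    then have h: "?h \<le> 5 * (?u * ?s)" by simp
    have B0: "?B \<ge> 0" by (intro sum_nonneg) auto
    \<comment> \<open>The first premise compares the two sums and the second the two cardinalities;
      both ratios meet at \<open>b / (u * s)\<close>.\<close>
    have average: "1 / s * a \<le> 5 * (1 / h * b)"
      if "u * a \<le> b" "h \<le> 5 * (u * s)" "b \<ge> 0" "u > 0" "s > 0" "h > 0" for a b h s u :: real
    proof -
      have "1 / s * a \<le> b / (u * s)" using that by (simp add: field_simps)
      also have "\<dots> \<le> 5 * (1 / h * b)"
        using mult_right_mono[OF that(2,3)] that(4-6) by (simp add: field_simps)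
      finally show ?thesis .
    qed
    have "1 / ?s * ?A \<le> 5 * (1 / ?h * ?B)"
      by (rule average[OF uA h B0 u0 s0 h0])
    then have "(1 / ?s * ?A) powr (1 / R') \<le> (5 * (1 / ?h * ?B)) powr (1 / R')"
      using R' by (intro powr_mono2) (auto intro!: divide_nonneg_nonneg sum_nonneg)
    also have "\<dots> = 5 powr (1 / R') * (1 / ?h * ?B) powr (1 / R')"
      using B0 by (intro powr_mult)
    \<comment> \<open>Since \<open>R' \<ge> 1\<close>, the exponent \<open>1 / R'\<close> is at most
      1, so the constant 5 serves all \<open>r\<close>.\<close>
    also have "\<dots> \<le> 5 powr 1 * (1 / ?h * ?B) powr (1 / R')"
      using R' by (intro mult_right_mono powr_mono) auto
    finally show ?thesis
      using False by (simp add: Lnorm_def R'_def)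
  qed
qed

end

theorem lemma3p4:
  fixes d :: nat
    and p s r :: ereal
    and Q :: "nat set"
    and F :: "nat \<Rightarrow> 'a ring"
    and \<chi> :: "nat \<Rightarrow> 'a \<Rightarrow> complex"
    and j :: "nat \<Rightarrow> 'a"
    and A :: "nat \<Rightarrow> ((nat \<Rightarrow> 'a) \<Rightarrow> complex) set"
  assumes "d \<ge> 2"
    and "1 \<le> p" and "1 \<le> s" and "1 \<le> r"
    and "\<And>q. q \<in> Q \<Longrightarrow> primepow q"
    and "\<And>q. q \<in> Q \<Longrightarrow> field (F q) \<and> card (carrier (F q)) = q"
    and "\<And>q. q \<in> Q \<Longrightarrow> nontrivial_additive_character (F q) (\<chi> q)"
    and "\<And>q. q \<in> Q \<Longrightarrow> j q \<in> carrier (F q) - {\<zero>\<^bsub>F q\<^esub>}"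
    and "\<And>q. q \<in> Q \<Longrightarrow> A q \<subseteq> vecs (F q) d \<rightarrow>\<^sub>E UNIV"
    and "\<exists>C>0. \<forall>q\<in>Q. \<forall>g\<in>A q.
           Lnorm r (Hvar (F q) d (j q)) (fourier (F q) (\<chi> q) (d + 1) (Sop (F q) (\<chi> q) d g))
             \<le> C * lnorm s (vecs (F q) (d + 1)) (Sop (F q) (\<chi> q) d g)
         \<and> lnorm s (vecs (F q) (d + 1)) (Sop (F q) (\<chi> q) d g)
             \<le> C * lnorm p (vecs (F q) d) g"
  shows "\<exists>C'>0. \<forall>q\<in>Q. \<forall>g\<in>A q.
           Lnorm r (Sphere (F q) d (j q)) (fourier (F q) (\<chi> q) d g)
             \<le> C' * lnorm p (vecs (F q) d) g"
proof -
  obtain C where C: "C > 0" and le: "\<And>q g. q \<in> Q \<Longrightarrow> g \<in> A q \<Longrightarrow>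
      Lnorm r (Hvar (F q) d (j q)) (fourier (F q) (\<chi> q) (d + 1) (Sop (F q) (\<chi> q) d g))
        \<le> C * lnorm s (vecs (F q) (d + 1)) (Sop (F q) (\<chi> q) d g)
      \<and> lnorm s (vecs (F q) (d + 1)) (Sop (F q) (\<chi> q) d g) \<le> C * lnorm p (vecs (F q) d) g"
    using assms(10) by blast
  \<comment> \<open>The factor 5 comes from passing from the sphere to \<open>Hvar\<close>, and one
    factor \<open>C\<close> from each of the two assumed inequalities; none depends on
    \<open>q\<close>.\<close>
  have "Lnorm r (Sphere (F q) d (j q)) (fourier (F q) (\<chi> q) d g)
      \<le> (5 * C * C) * lnorm p (vecs (F q) d) g" if q: "q \<in> Q" and g: "g \<in> A q" for q g
  proof -
    \<comment> \<open>Infinite sets have \<open>card\<close> equal to 0, so a positive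
      \<open>q\<close> forces the carrier to be finite.\<close>
    have "q > 0" using assms(5)[OF q] primepow_gt_0_nat by simp
    then have fin: "finite (carrier (F q))" using assms(6)[OF q] card_ge_0_finite by metis
    let ?G = "Sop (F q) (\<chi> q) d g"
    have "Lnorm r (Sphere (F q) d (j q)) (fourier (F q) (\<chi> q) d g)
        \<le> 5 * Lnorm r (Hvar (F q) d (j q)) (fourier (F q) (\<chi> q) (d + 1) ?G)"
      using assms(6)[OF q] assms(7)[OF q] assms(8)[OF q] assms(1,4) fin
      by (intro field.Lnorm_Sphere_le_Hvar) auto
    also have "\<dots> \<le> 5 * (C * lnorm s (vecs (F q) (d + 1)) ?G)"
      using le[OF q g] by simp
    also have "\<dots> \<le> 5 * (C * (C * lnorm p (vecs (F q) d) g))"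
      using le[OF q g] C by simp
    finally show ?thesis by (simp add: mult.assoc)
  qed
  moreover have "5 * C * C > 0" using C by simp
  ultimately show ?thesis by blast
qed

end
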